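(* Let $f:\mathbb{R}^n\to\mathbb{R}$ be locally Lipschitz, fix $\varepsilon>0$ and $\delta>0$, and let $\mathbf{x}_k\in\mathbb{R}^n$. Let $\mathcal V(\mathbf{x}_k)\subset\mathbb{R}^n$ be a nonempty finite set (of discrete gradients) such that, for some $\delta_k\ge 0$, $$\operatorname{conv}(\mathcal V(\mathbf{x}_k))\subset \partial_{\varepsilon} f(\mathbf{x}_k)+B(0,\delta_k).$$ Let $\mathcal G_\varepsilon(\mathbf{x}_k)\subset\mathbb{R}^n$ be a nonempty finite set such that, for some $\eta_k\ge 0$, $$\partial_\varepsilon f(\mathbf{x}_k)\subset \operatorname{conv}(\mathcal G_\varepsilon(\mathbf{x}_k))+B(0,\eta_k).$$ If $\mathbf{x}_k$ is a $(\delta,\mathcal V(\mathbf{x}_k))$ discrete-gradient Goldstein stationary point, i.e. $$\min\{\|\mathbf{v}\| : \mathbf{v}\in\operatorname{conv}(\mathcal V(\mathbf{x}_k))\}\le\delta,$$ then $\mathbf{x}_k$ is a $(\delta+\delta_k+\eta_k,\mathcal G_\varepsilon(\mathbf{x}_k))$ Goldstein stationary point, namely $$\min_{\mathbf{u}\in\operatorname{conv}(\mathcal G_\varepsilon(\mathbf{x}_k))}\|\mathbf{u}\|\le \delta+\delta_k+\eta_k.$$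
   Context: $\|\cdot\|$ is the Euclidean norm and $B(0,r)=\{\mathbf{y}\in\mathbb{R}^n:\|\mathbf{y}\|\le r\}$. For locally Lipschitz $f$, let $D_f$ be the set of points where $f$ is differentiable; the Clarke subdifferential is $\partial f(\mathbf{x})=\operatorname{conv}\{\mathbf{g}\in\mathbb{R}^n : \exists (\mathbf{x}_j)\subset D_f,\ \mathbf{x}_j\to\mathbf{x},\ \nabla f(\mathbf{x}_j)\to\mathbf{g}\}$. The Goldstein $\varepsilon$-subdifferential is $\partial_\varepsilon f(\mathbf{x})=\operatorname{cl}\operatorname{conv}\big(\bigcup_{\|\mathbf{y}-\mathbf{x}\|\le\varepsilon}\partial f(\mathbf{y})\big)$. For a nonempty finite set $\mathcal{S}\subset\mathbb{R}^n$ and $\delta'>0$, a point is called a $(\delta',\mathcal S)$ (discrete-gradient) Goldstein stationary point if $\min\{\|\mathbf{v}\|:\mathbf{v}\in\operatorname{conv}\mathcal S\}\le\delta'$. No property of $\mathcal V(\mathbf{x}_k)$ other than the stated ones (finiteness and the inclusion) enters the statement. *)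

theory Defs
  imports "HOL-Analysis.Analysis"
begin

definition locally_lipschitz :: "('a::metric_space \<Rightarrow> 'b::metric_space) \<Rightarrow> bool"
  where "locally_lipschitz f \<longleftrightarrow> (\<forall>x. \<exists>r>0. \<exists>L. L-lipschitz_on (cball x r) f)"

text \<open>
  \<open>GDERIV f (X j) :> G j\<close> says at once that \<open>f\<close> is (Frechet) differentiable at \<open>X j\<close> and that
  \<open>G j\<close> is its gradient there.
\<close>
definition clarke_subdiff :: "(real ^ 'n \<Rightarrow> real) \<Rightarrow> real ^ 'n \<Rightarrow> (real ^ 'n) set"
  where "clarke_subdiff f x =
    convex hull {g. \<exists>X G. (\<forall>j::nat. GDERIV f (X j) :> G j) \<and> X \<longlonglongrightarrow> x \<and> G \<longlonglongrightarrow> g}"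

definition goldstein_subdiff :: "real \<Rightarrow> (real ^ 'n \<Rightarrow> real) \<Rightarrow> real ^ 'n \<Rightarrow> (real ^ 'n) set"
  where "goldstein_subdiff \<epsilon> f x = closure (convex hull (\<Union>y\<in>cball x \<epsilon>. clarke_subdiff f y))"

text \<open>
  The minimum of the norm over \<open>convex hull S\<close> is attained and is at most \<open>d\<close>. (\<open>Min\<close> is not
  applicable: the hull is infinite in general.) The point whose stationarity is meant enters
  only through the set \<open>S\<close> attached to it.
\<close>
definition goldstein_stationary :: "real \<Rightarrow> (real ^ 'n) set \<Rightarrow> bool"
  where "goldstein_stationary d S \<longleftrightarrow>
    (\<exists>v. is_arg_min norm (\<lambda>v. v \<in> convex hull S) v \<and> norm v \<le> d)"

end

theory Submission
  imports Defs
begin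

text \<open>
  Each of the two inclusions up to a ball costs at most the radius of that ball: the stationary
  vector in the hull of \<open>V\<close> lies within \<open>\<delta>\<^sub>k\<close> of a Goldstein subgradient, which in turn
  lies within \<open>\<eta>\<^sub>k\<close> of some \<open>u\<close> in the hull of \<open>G\<close>. By the triangle inequality
  \<open>norm u \<le> \<delta> + \<delta>\<^sub>k + \<eta>\<^sub>k\<close>. The minimum of the norm over the hull of \<open>G\<close> is attained
  because the convex hull of a finite set is compact, so the bound on one vector \<open>u\<close> bounds it.
\<close>

lemma near_point_norm_le:
  fixes A B :: "'a::real_normed_vector set"
  assumes "A \<subseteq> B + cball 0 r" "a \<in> A"
  obtains b where "b \<in> B" "norm b \<le> norm a + r"
proof -
  from assms obtain b c where b: "b \<in> B" and c: "norm c \<le> r" and a: "a = b + c"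
    by (fastforce elim: set_plus_elim)
  have "norm b = norm (a - c)" by (simp add: a)
  also have "\<dots> \<le> norm a + r" using norm_triangle_ineq4[of a c] c by linarith
  finally show thesis using b that by blast
qed

text \<open>
  Attainment is automatic for a finite set, so stationarity can be certified by any one hull
  vector of small norm.
\<close>

lemma goldstein_stationaryI:
  assumes "finite S" "u \<in> convex hull S" "norm u \<le> d"
  shows "goldstein_stationary d S"
proof -
  have "compact (convex hull S)"
    using assms(1) by (rule finite_imp_compact_convex_hull)
  then obtain v where v: "v \<in> convex hull S" "\<forall>w\<in>convex hull S. norm v \<le> norm w"
    using continuous_attains_inf[of "convex hull S" norm] assms(2) continuous_on_norm_id
    by blast
  then show ?thesis
    unfolding goldstein_stationary_def is_arg_min_linorder
    using assms(2,3) by (meson order_trans)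
qed

theorem proposition1:
  fixes f :: "real ^ 'n \<Rightarrow> real" and x\<^sub>k :: "real ^ 'n"
    and V G :: "(real ^ 'n) set"
    and \<epsilon> \<delta> \<delta>\<^sub>k \<eta>\<^sub>k :: real
  assumes "locally_lipschitz f"
    and "\<epsilon> > 0" and "\<delta> > 0"
    and "finite V" and "V \<noteq> {}"
    and "\<delta>\<^sub>k \<ge> 0"
    and "convex hull V \<subseteq> goldstein_subdiff \<epsilon> f x\<^sub>k + cball 0 \<delta>\<^sub>k"
    and "finite G" and "G \<noteq> {}"
    and "\<eta>\<^sub>k \<ge> 0"
    and "goldstein_subdiff \<epsilon> f x\<^sub>k \<subseteq> convex hull G + cball 0 \<eta>\<^sub>k"
    and "goldstein_stationary \<delta> V"
  shows "goldstein_stationary (\<delta> + \<delta>\<^sub>k + \<eta>\<^sub>k) G"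
proof -
  from assms(12) obtain v where v: "v \<in> convex hull V" "norm v \<le> \<delta>"
    by (auto simp: goldstein_stationary_def is_arg_min_def)
  obtain g where g: "g \<in> goldstein_subdiff \<epsilon> f x\<^sub>k" "norm g \<le> norm v + \<delta>\<^sub>k"
    using near_point_norm_le[OF assms(7) v(1)] .
  obtain u where u: "u \<in> convex hull G" "norm u \<le> norm g + \<eta>\<^sub>k"
    using near_point_norm_le[OF assms(11) g(1)] .
  have "norm u \<le> \<delta> + \<delta>\<^sub>k + \<eta>\<^sub>k"
    using v(2) g(2) u(2) by linarith
  with assms(8) u(1) show ?thesis
    by (rule goldstein_stationaryI)
qed

end
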